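(* Let $h\geq 6$ be an integer and, for each $i\in\{1,\ldots,h\}$, let $\ell_i\geq 2$ be an integer. Then there exists an exclusively alt-colourable $4$-cycle decomposition of $K_{4\ell_1,\ldots,4\ell_h}$, the complete $h$-partite graph with parts of sizes $4\ell_1,\ldots,4\ell_h$ (where the parts are listed as $V_1,\ldots,V_h$ with $|V_i|=4\ell_i$ and the vertices of each part are totally ordered).
   Context: A $4$-cycle decomposition of a graph $G$ is a family of cycles of length $4$ in $G$ such that every edge of $G$ appears in exactly one of the cycles. A $2$-colouring of such a decomposition $\mathcal{D}$ is a map $\varphi$ from $V(G)$ to a set of two colours (not required to be surjective) such that no cycle of $\mathcal{D}$ is monochromatic, i.e. $|\varphi(V(C))|>1$ for all $C\in\mathcal{D}$. Let $G$ be a multipartite graph with parts $V_1,\ldots,V_h$ such that the vertices of each part are totally ordered, $V_i=\{v_{i,1}<v_{i,2}<\cdots<v_{i,|V_i|}\}$, and let $\mathcal{D}$ be a $4$-cycle decomposition of $G$. A $2$-colouring $\varphi$ of $\mathcal{D}$ is an alt-colouring if for every $i$ and all $j\in\{1,\ldots,|V_i|-1\}$, $\varphi(v_{i,j})\neq\varphi(v_{i,j+1})$. An alt-colouring $\varphi$ is a super-alt-colouring if in addition $\varphi(v_{i,|V_i|})\neq\varphi(v_{i+1,1})$ for all $i\in\{1,\ldots,h-1\}$. $\mathcal{D}$ is exclusively alt-colourable if $\mathcal{D}$ admits a super-alt-colouring and, moreover, every $2$-colouring of $\mathcal{D}$ is an alt-colouring. *)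

theory Defs
  imports Main
begin

text \<open>
  Simple graphs are given by their edge sets, edges being two-element sets. A cycle has no
  isolated vertices, so it too is identified with its edge set \<open>C\<close>, and its vertex set is \<open>\<Union>C\<close>.
\<close>

definition four_cycle :: "'a set set \<Rightarrow> bool" where
  "four_cycle C \<longleftrightarrow>
     (\<exists>a b c d. distinct [a, b, c, d] \<and> C = {{a, b}, {b, c}, {c, d}, {d, a}})"

text \<open>
  A family of cycles in which every edge lies in exactly one member has no repeated members,
  so a set of cycles loses nothing.
\<close>

definition four_cycle_decomposition :: "'a set set \<Rightarrow> 'a set set set \<Rightarrow> bool" where
  "four_cycle_decomposition E D \<longleftrightarrow>
     (\<forall>C\<in>D. four_cycle C \<and> C \<subseteq> E) \<and> (\<forall>e\<in>E. \<exists>!C. C \<in> D \<and> e \<in> C)"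

text \<open>The two colours are the elements of \<^typ>\<open>bool\<close>; values of \<open>\<phi>\<close> off the graph never matter.\<close>

definition two_colouring :: "'a set set set \<Rightarrow> ('a \<Rightarrow> bool) \<Rightarrow> bool" where
  "two_colouring D \<phi> \<longleftrightarrow> (\<forall>C\<in>D. card (\<phi> ` \<Union>C) > 1)"

text \<open>
  Ordered parts \<open>V\<^sub>1, \<dots>, V\<^sub>h\<close> are given by an enumeration \<open>v\<close>: the part \<open>V\<^sub>i\<close> (\<open>1 \<le> i \<le> h\<close>) consists of
  \<open>v i 1 < v i 2 < \<dots> < v i (n i)\<close>, so \<open>n i\<close> is its size. The ordering is the one given by the
  indices; no order on the type of vertices is involved.
\<close>

definition ordered_parts :: "nat \<Rightarrow> (nat \<Rightarrow> nat) \<Rightarrow> (nat \<Rightarrow> nat \<Rightarrow> 'a) \<Rightarrow> bool" where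
  "ordered_parts h n v \<longleftrightarrow> inj_on (\<lambda>(i, j). v i j) (SIGMA i:{1..h}. {1..n i})"

definition complete_multipartite :: "nat \<Rightarrow> (nat \<Rightarrow> nat) \<Rightarrow> (nat \<Rightarrow> nat \<Rightarrow> 'a) \<Rightarrow> 'a set set" where
  "complete_multipartite h n v =
     {{v i j, v i' j'} | i j i' j'.
        i \<in> {1..h} \<and> i' \<in> {1..h} \<and> i \<noteq> i' \<and> j \<in> {1..n i} \<and> j' \<in> {1..n i'}}"

definition alt_colouring ::
    "nat \<Rightarrow> (nat \<Rightarrow> nat) \<Rightarrow> (nat \<Rightarrow> nat \<Rightarrow> 'a) \<Rightarrow> 'a set set set \<Rightarrow> ('a \<Rightarrow> bool) \<Rightarrow> bool" where
  "alt_colouring h n v D \<phi> \<longleftrightarrow>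
     two_colouring D \<phi> \<and> (\<forall>i\<in>{1..h}. \<forall>j\<in>{1..<n i}. \<phi> (v i j) \<noteq> \<phi> (v i (j + 1)))"

definition super_alt_colouring ::
    "nat \<Rightarrow> (nat \<Rightarrow> nat) \<Rightarrow> (nat \<Rightarrow> nat \<Rightarrow> 'a) \<Rightarrow> 'a set set set \<Rightarrow> ('a \<Rightarrow> bool) \<Rightarrow> bool" where
  "super_alt_colouring h n v D \<phi> \<longleftrightarrow>
     alt_colouring h n v D \<phi> \<and> (\<forall>i\<in>{1..<h}. \<phi> (v i (n i)) \<noteq> \<phi> (v (i + 1) 1))"

definition exclusively_alt_colourable ::
    "nat \<Rightarrow> (nat \<Rightarrow> nat) \<Rightarrow> (nat \<Rightarrow> nat \<Rightarrow> 'a) \<Rightarrow> 'a set set set \<Rightarrow> bool" where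
  "exclusively_alt_colourable h n v D \<longleftrightarrow>
     (\<exists>\<phi>. super_alt_colouring h n v D \<phi>) \<and>
     (\<forall>\<phi>. two_colouring D \<phi> \<longrightarrow> alt_colouring h n v D \<phi>)"

end

theory Submission
  imports Defs
begin

text \<open>
  Orient the pairs of parts as a strongly connected tournament. For an arc from \<open>V\<^sub>i\<close> to \<open>V\<^sub>j\<close>, pair
  up vertices of equal parity in \<open>V\<^sub>i\<close>, and to each pair assign a perfect matching of \<open>V\<^sub>j\<close>, namely
  one of the two matchings that make up the Hamiltonian cycle through \<open>V\<^sub>j\<close> in its order; a pair
  together with an edge of its matching spans one 4-cycle. Matching edges join vertices of
  different parity, so the colouring by parity works.

  Given any 2-colouring, a majority in \<open>V\<^sub>i\<close> yields a monochromatic pair there, so along an arc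
  between unbalanced parts the majority colour changes. Hence no triangle consists of unbalanced
  parts, and one of \<open>V\<^sub>4, V\<^sub>5, V\<^sub>6\<close> is balanced. These have out-neighbours of all three pairing
  shapes, and the shapes and labels on the first eight vertices are such that some shape has
  monochromatic pairs assigned to both matchings. If \<open>V\<^sub>i\<close> is balanced, then monochromatic pairs
  occur in both colours, so \<open>V\<^sub>j\<close> is balanced and the matchings of all monochromatic pairs are
  bichromatic; if both matchings are, then \<open>V\<^sub>j\<close> alternates. Finally, alternation passes along
  arcs, hence reaches every part.
\<close>

section \<open>The tournament, the pairings and the matchings\<close>

definition arc :: "nat \<Rightarrow> nat \<Rightarrow> bool" where
  "arc i j \<longleftrightarrow> j = i + 1 \<or> j + 2 \<le> i"

definition shape :: "nat \<Rightarrow> nat" where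
  "shape j = (if j = 1 then 0 else if j = 2 then 1 else 2)"

text \<open>
  Vertices of a part are counted from 0. For \<open>k < 8\<close>, bit 0 of \<open>k\<close> is the parity class and bits
  1 and 2 form a vector \<open>(x, y)\<close> over the field of two elements. The shapes \<open>0, 1, 2\<close> add \<open>(1, 0)\<close>,
  \<open>(0, 1)\<close>, \<open>(1, 1)\<close> to it; these are the three perfect matchings of a four-element class.
\<close>

definition mate :: "nat \<Rightarrow> nat \<Rightarrow> nat" where
  "mate c k =
     (if c = 0 \<or> 8 \<le> k then if k mod 4 < 2 then k + 2 else k - 2
      else if c = 1 then if k < 4 then k + 4 else k - 4
      else if even k then 6 - k else 8 - k)"

text \<open>
  The labels of the shapes are the linear forms \<open>y\<close>, \<open>x\<close>, \<open>x + y\<close>, constant on mates, except that the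
  last one is negated on the odd class. If in both classes one of the four vertices has the
  minority colour, then each shape has one monochromatic pair in either class, and the negation
  rules out that their labels agree in every shape.
\<close>

definition label :: "nat \<Rightarrow> nat \<Rightarrow> bool" where
  "label c k \<longleftrightarrow> k \<in> (if c = 0 then {4, 5, 6, 7} else if c = 1 then {2, 3, 6, 7} else {1, 2, 4, 7})"

text \<open>For even \<open>n\<close>, the edges of the Hamiltonian cycle through 0, ...,
  \<open>n - 1\<close> lie alternately in the two matchings; the one for \<open>False\<close>
  contains the closing edge.\<close>

definition partner :: "bool \<Rightarrow> nat \<Rightarrow> nat \<Rightarrow> nat" where
  "partner b n m =
     (if b then if even m then m + 1 else m - 1
      else if odd m then if m + 1 = n then 0 else m + 1
      else if m = 0 then n - 1 else m - 1)"

text \<open>\<open>x\<close>, \<open>x'\<close> and \<open>y\<close>, \<open>y'\<close> are the two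
  pairs of opposite vertices.\<close>

definition quad :: "'a \<Rightarrow> 'a \<Rightarrow> 'a \<Rightarrow> 'a \<Rightarrow> 'a set set" where
  "quad x x' y y' = {{x, y}, {y, x'}, {x', y'}, {y', x}}"

definition pairing :: "nat \<Rightarrow> (nat \<Rightarrow> nat) \<Rightarrow> bool" where
  "pairing n p \<longleftrightarrow> (\<forall>k<n. p k < n \<and> p k \<noteq> k \<and> p (p k) = k)"

text \<open>Zero means balanced; being an integer, the value just changes sign with the
  colour.\<close>

definition excess :: "bool \<Rightarrow> nat \<Rightarrow> (nat \<Rightarrow> bool) \<Rightarrow> int" where
  "excess b n s = (\<Sum>k<n. if s k = b then 1 else - 1)"

definition alternating :: "nat \<Rightarrow> (nat \<Rightarrow> bool) \<Rightarrow> bool" where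
  "alternating n s \<longleftrightarrow> (\<forall>k. k + 1 < n \<longrightarrow> s k \<noteq> s (k + 1))"

section \<open>Mates and partners as fixed-point-free involutions\<close>

lemma lt8: "(k::nat) < 8 \<longleftrightarrow> k \<in> {0, 1, 2, 3, 4, 5, 6, 7}"
  by auto

lemma mate_small:
  assumes "k < 8"
  shows "mate c k < 8 \<and> mate c k \<noteq> k \<and> mate c (mate c k) = k \<and>
    (even (mate c k) \<longleftrightarrow> even k) \<and> (label c (mate c k) \<longleftrightarrow> label c k)"
proof -
  consider "c = 0" | "c = 1" | "c \<noteq> 0" "c \<noteq> 1" by blast
  then show ?thesis
    using assms unfolding lt8 by cases (elim insertE emptyE; simp add: mate_def label_def)+
qed

text \<open>From 8 on, every shape pairs within blocks of four consecutive indices, so the pairing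
  fits any part of size \<open>4 * l\<close> with \<open>l\<close> at least 2.\<close>

lemma mate_large:
  assumes "8 \<le> k"
  shows "8 \<le> mate c k \<and> mate c k \<noteq> k \<and> mate c (mate c k) = k \<and> mate c k div 4 = k div 4 \<and>
    (even (mate c k) \<longleftrightarrow> even k)"
proof -
  have eq: "mate c k' = (if k' mod 4 < 2 then k' + 2 else k' - 2)" if "8 \<le> k'" for k'
    using that by (simp add: mate_def)
  define q r where "q = k div 4" and "r = k mod 4"
  then have k: "k = 4 * q + r" and "r < 4" by simp_all
  then have "2 \<le> q" using assms by linarith
  from \<open>r < 4\<close> consider "r = 0" | "r = 1" | "r = 2" | "r = 3" by linarith
  then show ?thesis using \<open>2 \<le> q\<close> by cases (simp_all add: k eq, presburger+)
qed

lemma even_mate: "even (mate c k) \<longleftrightarrow> even k"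
  using mate_small[of k c] mate_large[of k c] by (cases "k < 8") auto

lemma label_mate: "label c (mate c k) \<longleftrightarrow> label c k"
proof (cases "k < 8")
  case False
  then have "8 \<le> mate c k" using mate_large[of k c] by simp
  with False show ?thesis by (auto simp: label_def)
qed (use mate_small in blast)

lemma pairing_mate:
  assumes "2 \<le> l"
  shows "pairing (4 * l) (mate c)"
  unfolding pairing_def
proof (intro allI impI)
  fix k assume k: "k < 4 * l"
  show "mate c k < 4 * l \<and> mate c k \<noteq> k \<and> mate c (mate c k) = k"
  proof (cases "k < 8")
    case True
    with mate_small[of k c] assms show ?thesis by simp
  next
    case False
    then have *: "mate c k div 4 = k div 4" "mate c k \<noteq> k" "mate c (mate c k) = k"
      using mate_large[of k c] by auto
    from k have "k div 4 < l" by (simp add: less_mult_imp_div_less mult.commute)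
    with *(1) have "mate c k div 4 < l" by simp
    then have "mate c k < 4 * l"
      using mult_div_mod_eq[of 4 "mate c k"] mod_less_divisor[of 4 "mate c k"] by linarith
    with * show ?thesis by simp
  qed
qed

lemma pairing_partner:
  assumes "even n"
  shows "pairing n (partner b n)"
  unfolding pairing_def
proof (intro allI impI)
  fix k assume k: "k < n"
  have b1: "k + 1 < n" if "even k" using that k assms by presburger
  show "partner b n k < n \<and> partner b n k \<noteq> k \<and> partner b n (partner b n k) = k"
    using k b1 assms by (cases b) (auto simp: partner_def elim!: oddE)
qed

lemma even_partner:
  assumes "even n" "m < n"
  shows "even (partner b n m) \<longleftrightarrow> odd m"
  using assms by (auto simp: partner_def)

section \<open>Colour excess and monochromatic pairs\<close>

text \<open>\<open>p\<close> permutes the indices, so summing over the mates gives the excess again;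
  each summand on the right is 2, 0 or -2.\<close>

lemma excess_pairing:
  assumes "pairing n p"
  shows "2 * excess b n s =
    (\<Sum>k<n. (if s k = b then 1 else - 1) + (if s (p k) = b then 1 else - 1))"
proof -
  have "excess b n s = (\<Sum>k<n. if s (p k) = b then 1 else - 1)"
    unfolding excess_def
    by (rule sum.reindex_bij_witness[of _ p p]) (use assms in \<open>auto simp: pairing_def\<close>)
  then show ?thesis by (simp add: sum.distrib excess_def)
qed

lemma excess_pos_imp_pair:
  assumes "pairing n p" "0 < excess b n s"
  shows "\<exists>k<n. s k = b \<and> s (p k) = b"
proof (rule ccontr)
  assume "\<not> ?thesis"
  then have "2 * excess b n s \<le> 0"
    unfolding excess_pairing[OF assms(1)] by (intro sum_nonpos) auto
  with assms(2) show False by simp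
qed

text \<open>A pair in the opposite colour contributes negatively, so a pair in colour
  \<open>b\<close> has to make up for it.\<close>

lemma excess_nonneg_imp_pair:
  assumes "pairing n p" "0 \<le> excess b n s" "k < n" "s k \<noteq> b" "s (p k) \<noteq> b"
  shows "\<exists>k<n. s k = b \<and> s (p k) = b"
proof (rule ccontr)
  assume none: "\<not> ?thesis"
  have "2 * excess b n s < (\<Sum>k<n. 0)"
    unfolding excess_pairing[OF assms(1)]
    by (rule sum_strict_mono_ex1) (use none assms in \<open>auto intro!: bexI[of _ k]\<close>)
  with assms(2) show False by simp
qed

lemma excess_Not: "excess (\<not> b) n s = - excess b n s"
  unfolding excess_def sum_negf[symmetric] by (rule sum.cong) auto

lemma alternatingI:
  assumes "\<And>b m. m < n \<Longrightarrow> t m \<noteq> t (partner b n m)"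
  shows "alternating n t"
  unfolding alternating_def
proof (intro allI impI)
  fix k assume "k + 1 < n"
  \<comment> \<open>The parity of \<open>k\<close> decides which matching contains the edge from
    \<open>k\<close> to \<open>k + 1\<close>.\<close>
  then have "partner (even k) n k = k + 1" by (simp add: partner_def)
  with assms[of k "even k"] \<open>k + 1 < n\<close> show "t k \<noteq> t (k + 1)" by simp
qed

lemma alternating_parity:
  assumes "alternating n s" "k < n"
  shows "s k = (s 0 = even k)"
  using assms(2)
proof (induction k)
  case (Suc k)
  then have "s k = (s 0 = even k)" "s k \<noteq> s (Suc k)"
    using assms(1) by (auto simp: alternating_def)
  then show ?case by auto
qed simp

text \<open>Partners differ in parity, so none are monochromatic and neither colour has positive
  excess.\<close>

lemma excess_alternating:
  assumes "alternating n s" "even n"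
  shows "excess b n s = 0"
proof -
  have "\<not> (s m = b \<and> s (partner True n m) = b)" if "m < n" for m b
    using that even_partner[OF assms(2) that] alternating_parity[OF assms(1)]
      pairing_partner[OF assms(2), of True] unfolding pairing_def by metis
  then have "excess b n s \<le> 0" for b
    using excess_pos_imp_pair[OF pairing_partner[OF assms(2), of True], of b s] by force
  from this[of b] this[of "\<not> b"] show ?thesis by (simp add: excess_Not)
qed

text \<open>In a parity class that is constant or split two and two, some shape has both pairs
  monochromatic, and they carry both labels. If both classes split three and one, the labels of the
  monochromatic pairs, added over the three shapes, give 1 modulo 2 in the even class and 0 in the
  odd class, so they differ in some shape.\<close>

lemma mono_pairs_of_both_labels:
  fixes s :: "nat \<Rightarrow> bool"
  shows "\<exists>c<3. \<forall>b. \<exists>k<8. s k = s (mate c k) \<and> label c k = b"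
proof -
  have ex8: "(\<exists>k<8. P k) \<longleftrightarrow> P 0 \<or> P 1 \<or> P 2 \<or> P 3 \<or> P 4 \<or> P 5 \<or> P 6 \<or> P (7::nat)" for P
    unfolding lt8 by auto
  have ex3: "(\<exists>c<3. P c) \<longleftrightarrow> P 0 \<or> P 1 \<or> P (2::nat)" for P
    by (auto simp: numeral_3_eq_3 less_Suc_eq numeral_2_eq_2)
  show ?thesis
    unfolding ex3 ex8 all_bool_eq
    by (simp add: mate_def label_def) argo
qed

section \<open>Passing balance and alternation along an arc\<close>

text \<open>The colouring condition on all cycles of one arc, in terms of the colourings
  \<open>s\<close> of its tail and \<open>t\<close> of its head.\<close>

definition compatible :: "nat \<Rightarrow> nat \<Rightarrow> nat \<Rightarrow> (nat \<Rightarrow> bool) \<Rightarrow> (nat \<Rightarrow> bool) \<Rightarrow> bool" where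
  "compatible c a n s t \<longleftrightarrow>
     (\<forall>k<a. \<forall>m<n. \<not> (s k = s (mate c k) \<and> s k = t m \<and> s k = t (partner (label c k) n m)))"

lemma compatible_excess:
  assumes "compatible c (4 * l) n s t" "2 \<le> l" "even n" "k < 4 * l" "s k = b" "s (mate c k) = b"
  shows "excess b n t \<le> 0"
proof (rule ccontr)
  assume "\<not> ?thesis"
  then obtain m where "m < n" "t m = b" "t (partner (label c k) n m) = b"
    using excess_pos_imp_pair[OF pairing_partner[OF assms(3)], of b t "label c k"] by auto
  with assms show False by (auto simp: compatible_def)
qed

text \<open>Balance of the tail turns one monochromatic pair into pairs of both colours, which
  forces the head to be balanced. A monochromatic edge in the assigned matching must avoid the
  colour of \<open>k\<close>, and balance then yields an edge in that colour, a
  contradiction.\<close>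

lemma compatible_balanced:
  assumes "compatible c (4 * l) n s t" "2 \<le> l" "even n" "\<And>b. excess b (4 * l) s = 0"
    and "k < 4 * l" "s k = s (mate c k)" "m < n"
  shows "t m \<noteq> t (partner (label c k) n m)"
proof
  assume mono: "t m = t (partner (label c k) n m)"
  have "\<exists>k<4 * l. s k = b \<and> s (mate c k) = b" for b
  proof (cases "s k = b")
    case True
    with assms(5,6) show ?thesis by (intro exI[of _ k]) simp
  next
    case False
    with assms(4-6) show ?thesis
      using excess_nonneg_imp_pair[OF pairing_mate[OF assms(2)], of b s k c] by simp
  qed
  then have "excess b n t \<le> 0" for b
    using compatible_excess[OF assms(1-3)] by blast
  from this[of "s k"] this[of "\<not> s k"] have "excess (s k) n t = 0" by (simp add: excess_Not)
  moreover have "t m \<noteq> s k" using assms(1,5-7) mono by (auto simp: compatible_def)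
  ultimately obtain m' where "m' < n" "t m' = s k" "t (partner (label c k) n m') = s k"
    using excess_nonneg_imp_pair[OF pairing_partner[OF assms(3)], of "s k" t m "label c k"]
      assms(7) mono by auto
  with assms(1,5,6) show False by (auto simp: compatible_def)
qed

lemma compatible_alternating:
  assumes "compatible c (4 * l) n s t" "2 \<le> l" "even n" "\<And>b. excess b (4 * l) s = 0"
    and "\<And>b. \<exists>k<8. s k = s (mate c k) \<and> label c k = b"
  shows "alternating n t"
proof (rule alternatingI)
  fix b m assume "m < n"
  obtain k where "k < 8" "s k = s (mate c k)" "label c k = b" using assms(5) by blast
  with compatible_balanced[OF assms(1-4), of k m] \<open>m < n\<close> assms(2)
  show "t m \<noteq> t (partner b n m)" by simp
qed

text \<open>Mates have equal parity, so all pairs are monochromatic, and every shape uses both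
  labels.\<close>

lemma alternating_propagates:
  assumes "compatible c (4 * l) n s t" "2 \<le> l" "even n" "alternating (4 * l) s"
  shows "alternating n t"
proof (rule compatible_alternating[OF assms(1-3)])
  show "excess b (4 * l) s = 0" for b
    by (rule excess_alternating[OF assms(4)]) simp
  fix b
  have "\<exists>k<8. label c k = b"
  proof (cases b)
    case True
    then show ?thesis by (intro exI[of _ "if c = 0 then 4 else 2"]) (simp add: label_def)
  qed (intro exI[of _ 0], simp add: label_def)
  then obtain k where k: "k < 8" "label c k = b" by blast
  then have "s k = s (mate c k)"
    using assms(2) mate_small[of k c] alternating_parity[OF assms(4), of k]
      alternating_parity[OF assms(4), of "mate c k"] by auto
  with k show "\<exists>k<8. s k = s (mate c k) \<and> label c k = b" by blast
qed

section \<open>Alternation in all parts\<close>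

lemma all_alternating:
  fixes s :: "nat \<Rightarrow> nat \<Rightarrow> bool"
  assumes h: "6 \<le> h" and l: "\<And>i. i \<in> {1..h} \<Longrightarrow> 2 \<le> l i"
    and compat: "\<And>i j. i \<in> {1..h} \<Longrightarrow> j \<in> {1..h} \<Longrightarrow> arc i j \<Longrightarrow>
      compatible (shape j) (4 * l i) (4 * l j) (s i) (s j)"
  shows "\<forall>i\<in>{1..h}. alternating (4 * l i) (s i)"
proof -
  let ?e = "\<lambda>b i. excess b (4 * l i) (s i)"
  have flip: "?e b j \<le> 0" if "i \<in> {1..h}" "j \<in> {1..h}" "arc i j" "0 < ?e b i" for i j b
  proof -
    have "\<exists>k<4 * l i. s i k = b \<and> s i (mate (shape j) k) = b"
      using excess_pos_imp_pair[OF pairing_mate[OF l] that(4)] that(1) .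
    then obtain k where "k < 4 * l i" "s i k = b" "s i (mate (shape j) k) = b" by blast
    then show ?thesis
      using compatible_excess[OF compat[OF that(1-3)] l[OF that(1)], of k b] by simp
  qed
  have "\<exists>i\<in>{4, 5, 6}. ?e True i = 0"
  proof -
    \<comment> \<open>Around a directed triangle of unbalanced parts the majority colour would
      change three times.\<close>
    have "arc 4 5" "arc 5 6" "arc 6 4" by (auto simp: arc_def)
    then have "0 < ?e b 4 \<Longrightarrow> ?e b 5 \<le> 0" "0 < ?e b 5 \<Longrightarrow> ?e b 6 \<le> 0"
      "0 < ?e b 6 \<Longrightarrow> ?e b 4 \<le> 0" for b
      using flip[of 4 5 b] flip[of 5 6 b] flip[of 6 4 b] h by auto
    from this[of True] this[of False] show ?thesis
      using excess_Not[of True] by simp linarith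
  qed
  then obtain i where i: "i \<in> {4, 5, 6}" "?e True i = 0" by blast
  then have ih: "i \<in> {1..h}" using h by auto
  have bal: "?e b i = 0" for b
    using i(2) excess_Not[of True "4 * l i" "s i"] by (cases b) auto
  obtain c where c: "c < 3" "\<And>b. \<exists>k<8. s i k = s i (mate c k) \<and> label c k = b"
    using mono_pairs_of_both_labels by blast
  obtain j where j: "j \<in> {1..h}" "arc i j" "shape j = c"
  proof -
    \<comment> \<open>Parts 1 and 2 supply shapes 0 and 1; shape 2 comes from part 5 if
      \<open>i\<close> is 4 and from part 3 otherwise.\<close>
    have "\<exists>j\<in>{1, 2, 3, 5}. arc i j \<and> shape j = c"
      using i(1) c(1) by (auto simp: arc_def shape_def)
    then obtain j' where "j' \<in> {1, 2, 3, 5}" "arc i j'" "shape j' = c" by blast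
    with that[of j'] h show ?thesis by auto
  qed
  have spread: "alternating (4 * l b) (s b)"
    if "alternating (4 * l a) (s a)" "a \<in> {1..h}" "b \<in> {1..h}" "arc a b" for a b
    using alternating_propagates[OF compat[OF that(2-4)] l[OF that(2)] _ that(1)] by simp
  have up: "alternating (4 * l b) (s b)"
    if "alternating (4 * l a) (s a)" "1 \<le> a" "a \<le> b" "b \<le> h" for a b
    using that(3,4)
  proof (induction b rule: dec_induct)
    case (step b)
    with that(2) show ?case by (intro spread[of b "Suc b"]) (auto simp: arc_def)
  qed (use that in simp)
  have "alternating (4 * l j) (s j)"
    using compatible_alternating[OF compat[OF ih j(1,2)] l[OF ih] _ bal] c(2) j(3) by simp
  then have "alternating (4 * l h) (s h)" using up[of j h] j(1) by simp
  \<comment> \<open>The backward arc from \<open>h\<close> to 1 closes the path 1, ...,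
    \<open>h\<close> into a cycle.\<close>
  then have "alternating (4 * l 1) (s 1)" using spread[of h 1] h by (simp add: arc_def)
  then show ?thesis using up[of 1] by simp
qed

section \<open>The cycles and their edges\<close>

lemma Union_quad: "\<Union>(quad x x' y y') = {x, x', y, y'}"
  by (auto simp: quad_def)

lemma quad_not_monochromatic:
  fixes \<phi> :: "'a \<Rightarrow> bool"
  shows "card (\<phi> ` \<Union>(quad x x' y y')) > 1 \<longleftrightarrow> \<not> (\<phi> x = \<phi> x' \<and> \<phi> x = \<phi> y \<and> \<phi> x = \<phi> y')"
  unfolding Union_quad by (cases "\<phi> x"; cases "\<phi> x'"; cases "\<phi> y"; cases "\<phi> y'") (simp_all add: insert_commute)

lemma quad_swap: "quad x' x y y' = quad x x' y y'" "quad x x' y' y = quad x x' y y'"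
  by (auto simp: quad_def insert_commute)

lemma four_cycle_quad:
  assumes "distinct [x, x', y, y']"
  shows "four_cycle (quad x x' y y')"
  unfolding four_cycle_def
  by (intro exI[of _ x] exI[of _ y] exI[of _ x'] exI[of _ y']) (use assms in \<open>auto simp: quad_def\<close>)

definition cycle ::
    "(nat \<Rightarrow> nat) \<Rightarrow> (nat \<Rightarrow> nat \<Rightarrow> 'a) \<Rightarrow> nat \<Rightarrow> nat \<Rightarrow> nat \<Rightarrow> nat \<Rightarrow> 'a set set" where
  "cycle l w i j k m =
     quad (w i k) (w i (mate (shape j) k))
       (w j m) (w j (partner (label (shape j) k) (4 * l j) m))"

definition cycles :: "nat \<Rightarrow> (nat \<Rightarrow> nat) \<Rightarrow> (nat \<Rightarrow> nat \<Rightarrow> 'a) \<Rightarrow> 'a set set set" where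
  "cycles h l w =
     {cycle l w i j k m | i j k m.
        i \<in> {1..h} \<and> j \<in> {1..h} \<and> arc i j \<and> k < 4 * l i \<and> m < 4 * l j}"

text \<open>Labels are constant on mates, and mates and partners are involutive, so it does not
  matter which ends of the pair and of the matching edge name the cycle.\<close>

lemma cycle_cong:
  assumes "2 \<le> l i" "k < 4 * l i" "m < 4 * l j"
    and "k' \<in> {k, mate (shape j) k}" "m' \<in> {m, partner (label (shape j) k) (4 * l j) m}"
  shows "cycle l w i j k' m' = cycle l w i j k m"
proof -
  have "mate (shape j) (mate (shape j) k) = k"
    using pairing_mate[OF assms(1)] assms(2) by (simp add: pairing_def)
  moreover have "partner b (4 * l j) (partner b (4 * l j) m) = m" for b
    using pairing_partner[of "4 * l j" b] assms(3) by (simp add: pairing_def)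
  ultimately show ?thesis
    using assms(4,5) by (auto simp: cycle_def label_mate quad_swap)
qed

lemma arc_asym: "arc i j \<Longrightarrow> \<not> arc j i"
  by (auto simp: arc_def)

lemma arc_total: "i \<noteq> j \<Longrightarrow> arc i j \<or> arc j i"
  by (auto simp: arc_def)

text \<open>By injectivity an edge determines its arc and both indices; the parameters of any cycle
  through it then agree up to mates and partners.\<close>

lemma decomposition_cycles:
  fixes w :: "nat \<Rightarrow> nat \<Rightarrow> 'a"
  assumes l: "\<And>i. i \<in> {1..h} \<Longrightarrow> 2 \<le> l i"
    and inj: "\<And>i j k m. \<lbrakk>i \<in> {1..h}; j \<in> {1..h}; k < 4 * l i; m < 4 * l j; w i k = w j m\<rbrakk> \<Longrightarrow>
      i = j \<and> k = m"
  shows "four_cycle_decomposition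
    {{w i k, w j m} | i j k m. i \<in> {1..h} \<and> j \<in> {1..h} \<and> arc i j \<and> k < 4 * l i \<and> m < 4 * l j}
    (cycles h l w)" (is "four_cycle_decomposition ?E _")
  unfolding four_cycle_decomposition_def
proof (intro conjI ballI)
  have mate_props: "mate c k < 4 * l i" "mate c k \<noteq> k" if "i \<in> {1..h}" "k < 4 * l i" for c i k
    using pairing_mate[OF l[OF that(1)]] that(2) by (auto simp: pairing_def)
  have partner_props: "partner b (4 * l j) m < 4 * l j" "partner b (4 * l j) m \<noteq> m"
    if "m < 4 * l j" for b j m
    using pairing_partner[of "4 * l j" b] that by (auto simp: pairing_def)
  fix C assume "C \<in> cycles h l w"
  then obtain i j k m where C: "C = cycle l w i j k m" and
    *: "i \<in> {1..h}" "j \<in> {1..h}" "arc i j" "k < 4 * l i" "m < 4 * l j"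
    unfolding cycles_def by blast
  have "i \<noteq> j" using *(3) by (auto simp: arc_def)
  have same: "w i a = w i b \<longleftrightarrow> a = b" if "i \<in> {1..h}" "a < 4 * l i" "b < 4 * l i" for i a b
    using inj[of i i a b] that by blast
  have diff: "w i a \<noteq> w j b" if "a < 4 * l i" "b < 4 * l j" for a b
    using inj[of i j a b] that * \<open>i \<noteq> j\<close> by blast
  show "four_cycle C"
    unfolding C cycle_def
  proof (rule four_cycle_quad)
    show "distinct [w i k, w i (mate (shape j) k), w j m,
        w j (partner (label (shape j) k) (4 * l j) m)]"
      using same[OF *(1,4) mate_props(1)[OF *(1,4)]] same[OF *(2,5) partner_props(1)[OF *(5)]]
        mate_props[OF *(1,4)] mate_props(2)[OF *(1,4), symmetric]
        partner_props[OF *(5)] partner_props(2)[OF *(5), symmetric] *(4,5) diff diff[symmetric]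
      by simp
  qed
  have in_E: "{w i k, w j m} \<in> ?E" "{w j m, w i k} \<in> ?E" if "k < 4 * l i" "m < 4 * l j" for k m
    using that *(1-3) by (auto simp: insert_commute)
  show "C \<subseteq> ?E"
    unfolding C cycle_def quad_def
    by (intro insert_subsetI empty_subsetI in_E mate_props(1)[OF *(1,4)]
        partner_props(1)[OF *(5)] *(4,5))
next
  have mate_props: "mate c k < 4 * l i" if "i \<in> {1..h}" "k < 4 * l i" for c i k
    using pairing_mate[OF l[OF that(1)]] that(2) by (auto simp: pairing_def)
  have partner_props: "partner b (4 * l j) m < 4 * l j" if "m < 4 * l j" for b j m
    using pairing_partner[of "4 * l j" b] that by (auto simp: pairing_def)
  fix e assume "e \<in> ?E"
  then obtain i j k m where e: "e = {w i k, w j m}" and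
    *: "i \<in> {1..h}" "j \<in> {1..h}" "arc i j" "k < 4 * l i" "m < 4 * l j"
    by blast
  show "\<exists>!C. C \<in> cycles h l w \<and> e \<in> C"
  proof (rule ex1I[of _ "cycle l w i j k m"], intro conjI)
    show "cycle l w i j k m \<in> cycles h l w" using * unfolding cycles_def by blast
    show "e \<in> cycle l w i j k m" by (simp add: e cycle_def quad_def)
  next
    fix C assume "C \<in> cycles h l w \<and> e \<in> C"
    then obtain i' j' k' m' where C: "C = cycle l w i' j' k' m'" and e_C: "e \<in> C" and
      C': "i' \<in> {1..h}" "j' \<in> {1..h}" "arc i' j'" "k' < 4 * l i'" "m' < 4 * l j'"
      unfolding cycles_def by blast
    from e_C obtain k'' m'' where
      mem: "k'' \<in> {k', mate (shape j') k'}" "m'' \<in> {m', partner (label (shape j') k') (4 * l j') m'}"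
      and e': "e = {w i' k'', w j' m''}"
      unfolding C cycle_def quad_def by blast
    have bounds: "k'' < 4 * l i'" "m'' < 4 * l j'"
      using mem C' mate_props partner_props by auto
    have "w i k = w i' k'' \<and> w j m = w j' m'' \<or> w i k = w j' m'' \<and> w j m = w i' k''"
      using e e' by (auto simp: doubleton_eq_iff)
    then have "i = i' \<and> k = k'' \<and> j = j' \<and> m = m''"
    proof
      assume "w i k = w i' k'' \<and> w j m = w j' m''"
      then show ?thesis using inj[of i i' k k''] inj[of j j' m m''] * C' bounds by simp
    next
      \<comment> \<open>Read backwards, the edge would give arcs in both directions.\<close>
      assume "w i k = w j' m'' \<and> w j m = w i' k''"
      then have "i = j'" "j = i'"
        using inj[of i j' k m''] inj[of j i' m k''] * C' bounds by simp_all
      with *(3) C'(3) arc_asym show ?thesis by blast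
    qed
    then show "C = cycle l w i j k m"
      unfolding C using cycle_cong[of l i' k' m' j' k'' m'' w] mem C' l by simp
  qed
qed

lemma two_colouring_cycles:
  "two_colouring (cycles h l w) \<phi> \<longleftrightarrow>
    (\<forall>i\<in>{1..h}. \<forall>j\<in>{1..h}. arc i j \<longrightarrow>
      compatible (shape j) (4 * l i) (4 * l j) (\<lambda>k. \<phi> (w i k)) (\<lambda>m. \<phi> (w j m)))"
proof -
  have "two_colouring (cycles h l w) \<phi> \<longleftrightarrow>
    (\<forall>i\<in>{1..h}. \<forall>j\<in>{1..h}. arc i j \<longrightarrow>
      (\<forall>k<4 * l i. \<forall>m<4 * l j. card (\<phi> ` \<Union>(cycle l w i j k m)) > 1))"
    unfolding two_colouring_def cycles_def by blast
  then show ?thesis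
    unfolding cycle_def quad_not_monochromatic compatible_def .
qed

lemma complete_multipartite_eq:
  "complete_multipartite h n v =
    {{v i (Suc k), v j (Suc m)} | i j k m.
      i \<in> {1..h} \<and> j \<in> {1..h} \<and> arc i j \<and> k < n i \<and> m < n j}" (is "_ = ?E")
proof
  show "?E \<subseteq> complete_multipartite h n v"
    unfolding complete_multipartite_def by (fastforce simp: arc_def)
  show "complete_multipartite h n v \<subseteq> ?E"
  proof
    fix e assume "e \<in> complete_multipartite h n v"
    then obtain i j k m where e: "e = {v i k, v j m}" and
      *: "i \<in> {1..h}" "j \<in> {1..h}" "i \<noteq> j" "k \<in> {1..n i}" "m \<in> {1..n j}"
      unfolding complete_multipartite_def by blast
    from *(4,5) obtain k' m' where "k = Suc k'" "m = Suc m'" "k' < n i" "m' < n j"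
      by (metis Suc_le_D atLeastAtMost_iff less_eq_Suc_le One_nat_def)
    with e *(1,2) arc_total[OF *(3)] show "e \<in> ?E"
      using insert_commute by blast
  qed
qed

theorem theorem1p1:
  fixes h :: nat and l :: "nat \<Rightarrow> nat" and v :: "nat \<Rightarrow> nat \<Rightarrow> 'a"
  assumes "h \<ge> 6"
    and "\<And>i. i \<in> {1..h} \<Longrightarrow> l i \<ge> 2"
    and "ordered_parts h (\<lambda>i. 4 * l i) v"
  shows "\<exists>D. four_cycle_decomposition (complete_multipartite h (\<lambda>i. 4 * l i) v) D \<and>
             exclusively_alt_colourable h (\<lambda>i. 4 * l i) v D"
proof -
  define w where "w i k = v i (Suc k)" for i k
  define D where "D = cycles h l w"
  have inj: "i = j \<and> k = m"
    if "i \<in> {1..h}" "j \<in> {1..h}" "k \<in> {1..4 * l i}" "m \<in> {1..4 * l j}" "v i k = v j m" for i j k m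
    using inj_onD[OF assms(3)[unfolded ordered_parts_def], of "(i, k)" "(j, m)"] that by simp
  have decomposition: "four_cycle_decomposition (complete_multipartite h (\<lambda>i. 4 * l i) v) D"
    unfolding complete_multipartite_eq D_def w_def[symmetric]
  proof (rule decomposition_cycles[OF assms(2)])
    fix i j k m
    assume "i \<in> {1..h}" "j \<in> {1..h}" "k < 4 * l i" "m < 4 * l j" "w i k = w j m"
    then show "i = j \<and> k = m" using inj[of i j "Suc k" "Suc m"] by (simp add: w_def)
  qed
  \<comment> \<open>By \<open>inj\<close> this is the parity of the index, counted from 1; off the
    graph the value defaults to \<open>False\<close>.\<close>
  define \<phi> where "\<phi> x \<longleftrightarrow> (\<exists>i\<in>{1..h}. \<exists>k\<in>{1..4 * l i}. x = v i k \<and> even k)" for x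
  have \<phi>: "\<phi> (v i k) \<longleftrightarrow> even k" if "i \<in> {1..h}" "k \<in> {1..4 * l i}" for i k
    unfolding \<phi>_def using that inj by blast
  have "two_colouring D \<phi>"
    unfolding D_def two_colouring_cycles compatible_def
  proof (intro ballI allI impI)
    fix i j k m assume *: "i \<in> {1..h}" "j \<in> {1..h}" "k < 4 * l i" "m < 4 * l j"
    let ?m = "partner (label (shape j) k) (4 * l j) m"
    have "?m < 4 * l j"
      using pairing_partner[of "4 * l j" "label (shape j) k"] *(4) by (simp add: pairing_def)
    \<comment> \<open>Partners differ in parity, so the pair in the head is never
      monochromatic.\<close>
    then have "\<phi> (w j m) \<noteq> \<phi> (w j ?m)"
      using \<phi>[OF *(2)] *(4) even_partner[of "4 * l j" m] by (simp add: w_def)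
    then show "\<not> (\<phi> (w i k) = \<phi> (w i (mate (shape j) k)) \<and> \<phi> (w i k) = \<phi> (w j m) \<and>
        \<phi> (w i k) = \<phi> (w j ?m))" by blast
  qed
  then have "super_alt_colouring h (\<lambda>i. 4 * l i) v D \<phi>"
    unfolding super_alt_colouring_def alt_colouring_def
  proof (intro conjI ballI)
    fix i j assume "i \<in> {1..h}" "j \<in> {1..<4 * l i}"
    then show "\<phi> (v i j) \<noteq> \<phi> (v i (j + 1))" by (simp add: \<phi>)
  next
    fix i assume "i \<in> {1..<h}"
    then have i: "i \<in> {1..h}" "i + 1 \<in> {1..h}" by auto
    \<comment> \<open>The last index of a part is even, and the next part starts at the odd index
      1.\<close>
    then show "\<phi> (v i (4 * l i)) \<noteq> \<phi> (v (i + 1) 1)"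
      using \<phi>[OF i(1), of "4 * l i"] \<phi>[OF i(2), of 1] assms(2)[OF i(1)] assms(2)[OF i(2)] by simp
  qed
  moreover have "alt_colouring h (\<lambda>i. 4 * l i) v D \<psi>" if "two_colouring D \<psi>" for \<psi>
  proof -
    have *: "\<forall>i\<in>{1..h}. alternating (4 * l i) (\<lambda>k. \<psi> (w i k))"
    proof (rule all_alternating[OF assms(1,2)])
      fix i j assume "i \<in> {1..h}" "j \<in> {1..h}" "arc i j"
      with that[unfolded D_def two_colouring_cycles]
      show "compatible (shape j) (4 * l i) (4 * l j) (\<lambda>k. \<psi> (w i k)) (\<lambda>k. \<psi> (w j k))"
        by blast
    qed
    have "\<psi> (v i j) \<noteq> \<psi> (v i (j + 1))" if "i \<in> {1..h}" "j \<in> {1..<4 * l i}" for i j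
    proof -
      have "alternating (4 * l i) (\<lambda>k. \<psi> (w i k))" "j - 1 + 1 < 4 * l i" "Suc (j - 1) = j"
        using * that by auto
      then show ?thesis unfolding alternating_def w_def by (metis Suc_eq_plus1)
    qed
    with that show ?thesis by (simp add: alt_colouring_def)
  qed
  ultimately show ?thesis
    using decomposition unfolding exclusively_alt_colourable_def by blast
qed

end
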